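(* Let $V$ and $W$ be absolute matrix order unit spaces and let $\phi,\psi:V\to W$ be completely $|\cdot|$-preserving maps such that $\phi\perp\psi$ (i.e. $\phi$ is completely orthogonal to $\psi$). Then $\phi+\psi$ is also a completely $|\cdot|$-preserving map.
   Context: **Absolute matrix order unit spaces.** $M_{m,n}(V)$ denotes $m\times n$ matrices over $V$, $M_{m,n}=M_{m,n}(\mathbb C)$ with operator norm, $v\oplus w$ is the block diagonal matrix. A matrix ordered space is a complex vector space $V$ with involution (with $[v_{ij}]^*=[v_{ji}^*]$ on matrices) and cones $M_n(V)^+\subset M_n(V)_{sa}$ such that each $(M_n(V)_{sa},M_n(V)^+)$ is a real ordered vector space and $a^*va\in M_m(V)^+$ for $v\in M_n(V)^+$, $a\in M_{n,m}$. It is a matrix order unit space with order unit $e\in V^+$ if $e$ is an order unit for $V_{sa}$, $V^+$ is proper and every $M_n(V)^+$ is Archimedean (if $u\in M_n(V)^+$, $v\in M_n(V)_{sa}$ and $ku+v\in M_n(V)^+$ for all $k>0$, then $v\in M_n(V)^+$). Put $e^n=e\oplus\cdots\oplus e\in M_n(V)$ and $\|v\|_n=\inf\left\{k>0:\begin{bmatrix} ke^n & v \\ v^* & ke^n \end{bmatrix}\in M_{2n}(V)^+\right\}$. An absolutely ordered space $(X,X^+,|\cdot|)$ is a real ordered vector space with $|\cdot|:X\to X^+$ such that: $|v|=v$ for $v\in X^+$; $|v|\pm v\in X^+$; $|kv|=|k||v|$ for $k\in\mathbb R$; if $|u-v|=u+v$ and $0\le w\le v$ then $|u-w|=u+w$;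 if $|u-v|=u+v$ and $|u-w|=u+w$ then $\big|u-|v\pm w|\big|=u+|v\pm w|$. For $u,v\in X^+$ write $u\perp v$ if $|u-v|=u+v$. An absolute matrix order unit space is a matrix order unit space $(V,\{M_n(V)^+\},e)$ with maps $|\cdot|_{m,n}:M_{m,n}(V)\to M_n(V)^+$ ($|\cdot|_n:=|\cdot|_{n,n}$) such that: (1) each $(M_n(V)_{sa},M_n(V)^+,|\cdot|_n)$ is an absolutely ordered space; (2) $|\alpha v\beta|_{r,s}\le\|\alpha\|\,\big||v|_{m,n}\beta\big|_{n,s}$ for $v\in M_{m,n}(V)$, $\alpha\in M_{r,m}$, $\beta\in M_{n,s}$; (3) $|v\oplus w|_{m+r,n+s}=|v|_{m,n}\oplus|w|_{r,s}$; (4) $\perp=\perp^a_\infty$ on each $M_n(V)^+$, where $u\perp_\infty v$ means $\|k_1u+k_2v\|_n=\max\{\|k_1u\|_n,\|k_2v\|_n\}$ for all $k_1,k_2\in\mathbb R$, and $u\perp^a_\infty v$ means $u_1\perp_\infty v_1$ whenever $0\le u_1\le u$, $0\le v_1\le v$. **Maps.** For a linear $\phi:V\to W$, $\phi_n:M_n(V)\to M_n(W)$ is the entrywise amplification. A $*$-linear map $\phi$ is completely $|\cdot|$-preserving if $|\phi_n(v)|_n=\phi_n(|v|_n)$ for all $v\in M_n(V)$, $n\in\mathbb N$ (such a map is completely positive). Completely positive maps $\phi,\psi:V\to W$ are completely orthogonal, written $\phi\perp\psi$, if for every $n\in\mathbb N$ one has $\phi_n(u)\perp\psi_n(v)$ for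 all $u,v\in M_n(V)^+$. *)

theory Defs
  imports
    "HOL-Analysis.L2_Norm"
    "Jordan_Normal_Form.Schur_Decomposition"
begin

text \<open>
  A complex vector space V is a whole type \<open>'v\<close> with an explicit scalar multiplication \<open>scale\<close>,
  and \<open>M\<^bsub>m,n\<^esub>(V)\<close> is \<open>carrier_mat m n :: 'v mat set\<close>. The type \<open>'v mat\<close> also contains matrices with
  no rows or no columns; since the theory concerns sizes \<open>m, n \<ge> 1\<close> only, every axiom and every
  definition below is restricted to positive sizes.
\<close>

definition smult_mat_space :: "(complex \<Rightarrow> 'v \<Rightarrow> 'v) \<Rightarrow> complex \<Rightarrow> 'v mat \<Rightarrow> 'v mat" where
  "smult_mat_space scale k v = map_mat (scale k) v"

definition left_mult :: "(complex \<Rightarrow> 'v \<Rightarrow> 'v) \<Rightarrow> complex mat \<Rightarrow> 'v::comm_monoid_add mat \<Rightarrow> 'v mat" where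
  "left_mult scale \<alpha> v =
     mat (dim_row \<alpha>) (dim_col v) (\<lambda>(i, j). \<Sum>k<dim_row v. scale (\<alpha> $$ (i, k)) (v $$ (k, j)))"

definition right_mult :: "(complex \<Rightarrow> 'v \<Rightarrow> 'v) \<Rightarrow> 'v::comm_monoid_add mat \<Rightarrow> complex mat \<Rightarrow> 'v mat" where
  "right_mult scale v \<beta> =
     mat (dim_row v) (dim_col \<beta>) (\<lambda>(i, j). \<Sum>k<dim_col v. scale (\<beta> $$ (k, j)) (v $$ (i, k)))"

definition star_mat :: "('v \<Rightarrow> 'v) \<Rightarrow> 'v mat \<Rightarrow> 'v mat" where
  "star_mat star v = mat (dim_col v) (dim_row v) (\<lambda>(i, j). star (v $$ (j, i)))"

definition selfadjoint_mats :: "('v \<Rightarrow> 'v) \<Rightarrow> nat \<Rightarrow> 'v mat set" where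
  "selfadjoint_mats star n = {v \<in> carrier_mat n n. star_mat star v = v}"

definition mat_direct_sum :: "'v::zero mat \<Rightarrow> 'v mat \<Rightarrow> 'v mat" where
  "mat_direct_sum v w =
     four_block_mat v (0\<^sub>m (dim_row v) (dim_col w)) (0\<^sub>m (dim_row w) (dim_col v)) w"

text \<open>\<open>unit_mat e n\<close> is \<open>e\<^sup>n = e \<oplus> \<dots> \<oplus> e\<close>.\<close>

definition unit_mat :: "'v::zero \<Rightarrow> nat \<Rightarrow> 'v mat" where
  "unit_mat e n = mat n n (\<lambda>(i, j). if i = j then e else 0)"

text \<open>The identification of V with \<open>M\<^sub>1(V)\<close>.\<close>

definition mat1 :: "'v \<Rightarrow> 'v mat" where
  "mat1 v = mat 1 1 (\<lambda>_. v)"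

definition op_norm :: "complex mat \<Rightarrow> real" where
  "op_norm \<alpha> = Sup {L2_set (\<lambda>i. cmod ((\<alpha> *\<^sub>v x) $ i)) {..<dim_row \<alpha>} | x.
     x \<in> carrier_vec (dim_col \<alpha>) \<and> L2_set (\<lambda>j. cmod (x $ j)) {..<dim_col \<alpha>} \<le> 1}"

text \<open>
  The space is a subset X of a type, because it is going to be the set of self-adjoint elements of
  \<open>M\<^sub>n(V)\<close>. As these are matrices over a vector space, the vector space identities hold anyway, so it
  suffices to ask that X be closed under the operations. The cone P need not be proper.
\<close>

definition real_ordered_space :: "(real \<Rightarrow> 'x \<Rightarrow> 'x) \<Rightarrow> 'x::plus set \<Rightarrow> 'x set \<Rightarrow> bool" where
  "real_ordered_space s X P \<longleftrightarrow>
     (\<forall>u\<in>X. \<forall>v\<in>X. u + v \<in> X) \<and> (\<forall>k. \<forall>v\<in>X. s k v \<in> X) \<and>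
     P \<subseteq> X \<and> P \<noteq> {} \<and> (\<forall>u\<in>P. \<forall>v\<in>P. u + v \<in> P) \<and> (\<forall>k\<ge>0. \<forall>v\<in>P. s k v \<in> P)"

definition orthogonal_wrt :: "('x \<Rightarrow> 'x) \<Rightarrow> 'x::{plus,minus} \<Rightarrow> 'x \<Rightarrow> bool" where
  "orthogonal_wrt a u v \<longleftrightarrow> a (u - v) = u + v"

definition absolutely_ordered_space ::
  "(real \<Rightarrow> 'x \<Rightarrow> 'x) \<Rightarrow> 'x::{plus,minus} set \<Rightarrow> 'x set \<Rightarrow> ('x \<Rightarrow> 'x) \<Rightarrow> bool" where
  "absolutely_ordered_space s X P a \<longleftrightarrow>
     real_ordered_space s X P \<and>
     (\<forall>v\<in>X. a v \<in> P) \<and>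
     (\<forall>v\<in>P. a v = v) \<and>
     (\<forall>v\<in>X. a v + v \<in> P \<and> a v - v \<in> P) \<and>
     (\<forall>k. \<forall>v\<in>X. a (s k v) = s \<bar>k\<bar> (a v)) \<and>
     (\<forall>u\<in>X. \<forall>v\<in>X. \<forall>w\<in>X.
        a (u - v) = u + v \<and> w \<in> P \<and> v - w \<in> P \<longrightarrow> a (u - w) = u + w) \<and>
     (\<forall>u\<in>X. \<forall>v\<in>X. \<forall>w\<in>X.
        a (u - v) = u + v \<and> a (u - w) = u + w \<longrightarrow>
        a (u - a (v + w)) = u + a (v + w) \<and> a (u - a (v - w)) = u + a (v - w))"

locale matrix_ordered_space = vector_space scale
  for scale :: "complex \<Rightarrow> 'v::ab_group_add \<Rightarrow> 'v" +
  fixes star :: "'v \<Rightarrow> 'v"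
    and pos :: "nat \<Rightarrow> 'v mat set"
  assumes star_add: "star (x + y) = star x + star y"
    and star_scale: "star (scale c x) = scale (cnj c) (star x)"
    and star_star: "star (star x) = x"
    and ordered: "n > 0 \<Longrightarrow>
      real_ordered_space (\<lambda>k. smult_mat_space scale (complex_of_real k))
        (selfadjoint_mats star n) (pos n)"
    and conj_pos: "m > 0 \<Longrightarrow> n > 0 \<Longrightarrow> v \<in> pos n \<Longrightarrow> a \<in> carrier_mat n m \<Longrightarrow>
      right_mult scale (left_mult scale (mat_adjoint a) v) a \<in> pos m"

locale matrix_order_unit_space = matrix_ordered_space scale star pos
  for scale :: "complex \<Rightarrow> 'v::ab_group_add \<Rightarrow> 'v"
    and star :: "'v \<Rightarrow> 'v"
    and pos :: "nat \<Rightarrow> 'v mat set" +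
  fixes e :: 'v
  assumes unit_pos: "mat1 e \<in> pos 1"
    and order_unit: "star x = x \<Longrightarrow>
      \<exists>k>0. mat1 (scale (complex_of_real k) e + x) \<in> pos 1 \<and>
             mat1 (scale (complex_of_real k) e - x) \<in> pos 1"
    and proper: "mat1 x \<in> pos 1 \<Longrightarrow> mat1 (- x) \<in> pos 1 \<Longrightarrow> x = 0"
    and archimedean: "n > 0 \<Longrightarrow> u \<in> pos n \<Longrightarrow> v \<in> selfadjoint_mats star n \<Longrightarrow>
      (\<And>k::real. k > 0 \<Longrightarrow> smult_mat_space scale (complex_of_real k) u + v \<in> pos n) \<Longrightarrow> v \<in> pos n"
begin

definition mat_norm :: "'v mat \<Rightarrow> real" where
  "mat_norm v =
     (let n = dim_row v in
      Inf {k::real. k > 0 \<and>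
        four_block_mat
          (smult_mat_space scale (complex_of_real k) (unit_mat e n)) v
          (star_mat star v) (smult_mat_space scale (complex_of_real k) (unit_mat e n)) \<in> pos (2 * n)})"

definition orthogonal_inf :: "'v mat \<Rightarrow> 'v mat \<Rightarrow> bool" where
  "orthogonal_inf u v \<longleftrightarrow> (\<forall>k1 k2 :: real.
     mat_norm (smult_mat_space scale (complex_of_real k1) u +
               smult_mat_space scale (complex_of_real k2) v) =
     max (mat_norm (smult_mat_space scale (complex_of_real k1) u))
         (mat_norm (smult_mat_space scale (complex_of_real k2) v)))"

definition abs_orthogonal_inf :: "nat \<Rightarrow> 'v mat \<Rightarrow> 'v mat \<Rightarrow> bool" where
  "abs_orthogonal_inf n u v \<longleftrightarrow>
     (\<forall>u1 v1. u1 \<in> pos n \<and> u - u1 \<in> pos n \<and> v1 \<in> pos n \<and> v - v1 \<in> pos n \<longrightarrow>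
        orthogonal_inf u1 v1)"

end

text \<open>
  Since a matrix determines its size, the family of maps \<open>|\<cdot>|\<^bsub>m,n\<^esub>\<close> is a single function \<open>absm\<close>, whose
  restriction to \<open>carrier_mat m n\<close> is \<open>|\<cdot>|\<^bsub>m,n\<^esub>\<close>.
\<close>

locale absolute_matrix_order_unit_space = matrix_order_unit_space scale star pos e
  for scale :: "complex \<Rightarrow> 'v::ab_group_add \<Rightarrow> 'v"
    and star :: "'v \<Rightarrow> 'v"
    and pos :: "nat \<Rightarrow> 'v mat set"
    and e :: 'v +
  fixes absm :: "'v mat \<Rightarrow> 'v mat"
  assumes abs_pos: "m > 0 \<Longrightarrow> n > 0 \<Longrightarrow> v \<in> carrier_mat m n \<Longrightarrow> absm v \<in> pos n"
    and absolutely_ordered: "n > 0 \<Longrightarrow>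
      absolutely_ordered_space (\<lambda>k. smult_mat_space scale (complex_of_real k))
        (selfadjoint_mats star n) (pos n) absm"
    and abs_mult: "m > 0 \<Longrightarrow> n > 0 \<Longrightarrow> r > 0 \<Longrightarrow> s > 0 \<Longrightarrow>
      v \<in> carrier_mat m n \<Longrightarrow> \<alpha> \<in> carrier_mat r m \<Longrightarrow> \<beta> \<in> carrier_mat n s \<Longrightarrow>
      smult_mat_space scale (complex_of_real (op_norm \<alpha>)) (absm (right_mult scale (absm v) \<beta>))
        - absm (right_mult scale (left_mult scale \<alpha> v) \<beta>) \<in> pos s"
    and abs_direct_sum: "m > 0 \<Longrightarrow> n > 0 \<Longrightarrow> r > 0 \<Longrightarrow> s > 0 \<Longrightarrow>
      v \<in> carrier_mat m n \<Longrightarrow> w \<in> carrier_mat r s \<Longrightarrow>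
      absm (mat_direct_sum v w) = mat_direct_sum (absm v) (absm w)"
    and orthogonal_iff: "n > 0 \<Longrightarrow> u \<in> pos n \<Longrightarrow> v \<in> pos n \<Longrightarrow>
      orthogonal_wrt absm u v \<longleftrightarrow> abs_orthogonal_inf n u v"

text \<open>The amplification \<open>\<phi>\<^sub>n\<close> is \<open>map_mat \<phi>\<close> on \<open>carrier_mat n n\<close>.\<close>

definition completely_abs_preserving ::
  "(complex \<Rightarrow> 'v::ab_group_add \<Rightarrow> 'v) \<Rightarrow> ('v \<Rightarrow> 'v) \<Rightarrow> ('v mat \<Rightarrow> 'v mat) \<Rightarrow>
   (complex \<Rightarrow> 'w::ab_group_add \<Rightarrow> 'w) \<Rightarrow> ('w \<Rightarrow> 'w) \<Rightarrow> ('w mat \<Rightarrow> 'w mat) \<Rightarrow> ('v \<Rightarrow> 'w) \<Rightarrow> bool" where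
  "completely_abs_preserving scaleV starV absV scaleW starW absW \<phi> \<longleftrightarrow>
     Vector_Spaces.linear scaleV scaleW \<phi> \<and>
     (\<forall>v. \<phi> (starV v) = starW (\<phi> v)) \<and>
     (\<forall>n>0. \<forall>v\<in>carrier_mat n n. absW (map_mat \<phi> v) = map_mat \<phi> (absV v))"

definition completely_positive ::
  "(complex \<Rightarrow> 'v::ab_group_add \<Rightarrow> 'v) \<Rightarrow> (nat \<Rightarrow> 'v mat set) \<Rightarrow>
   (complex \<Rightarrow> 'w::ab_group_add \<Rightarrow> 'w) \<Rightarrow> (nat \<Rightarrow> 'w mat set) \<Rightarrow> ('v \<Rightarrow> 'w) \<Rightarrow> bool" where
  "completely_positive scaleV posV scaleW posW \<phi> \<longleftrightarrow>
     Vector_Spaces.linear scaleV scaleW \<phi> \<and>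
     (\<forall>n>0. \<forall>v\<in>posV n. map_mat \<phi> v \<in> posW n)"

definition completely_orthogonal ::
  "(complex \<Rightarrow> 'v::ab_group_add \<Rightarrow> 'v) \<Rightarrow> (nat \<Rightarrow> 'v mat set) \<Rightarrow>
   (complex \<Rightarrow> 'w::ab_group_add \<Rightarrow> 'w) \<Rightarrow> (nat \<Rightarrow> 'w mat set) \<Rightarrow> ('w mat \<Rightarrow> 'w mat) \<Rightarrow>
   ('v \<Rightarrow> 'w) \<Rightarrow> ('v \<Rightarrow> 'w) \<Rightarrow> bool" where
  "completely_orthogonal scaleV posV scaleW posW absW \<phi> \<psi> \<longleftrightarrow>
     completely_positive scaleV posV scaleW posW \<phi> \<and>
     completely_positive scaleV posV scaleW posW \<psi> \<and>
     (\<forall>n>0. \<forall>u\<in>posV n. \<forall>v\<in>posV n. orthogonal_wrt absW (map_mat \<phi> u) (map_mat \<psi> v))"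

end

theory Submission
  imports Defs
begin

text \<open>
  On self-adjoint matrices, \<open>2v = p - m\<close> with \<open>p = \<bar>v\<bar> + v\<close> and \<open>m = \<bar>v\<bar> - v\<close> orthogonal.
  Each of \<open>\<phi>(p)\<close>, \<open>\<psi>(p)\<close> is orthogonal to each of \<open>\<phi>(m)\<close>, \<open>\<psi>(m)\<close>, and orthogonality is additive
  on the cone, so \<open>\<phi> + \<psi>\<close> preserves \<open>\<bar>v\<bar>\<close>. A general \<open>v\<close> is reduced to the self-adjoint matrix
  with zero diagonal blocks and off-diagonal blocks \<open>v\<close> and \<open>v\<^sup>*\<close>: a permutation of rows turns it into
  \<open>v\<^sup>* \<oplus> v\<close>, and the module axiom for \<open>\<bar>\<cdot>\<bar>\<close> shows that such a permutation leaves the absolute value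
  unchanged. Hence its absolute value is \<open>\<bar>v\<^sup>*\<bar> \<oplus> \<bar>v\<bar>\<close>.
\<close>

section \<open>Permutation matrices acting on rows\<close>

text \<open>With this convention, left multiplication puts row \<open>p i\<close> of the argument
  into row \<open>i\<close>, so it agrees with \<open>permute_rows p\<close> without passing to an
  inverse.\<close>

definition row_perm_mat :: "nat \<Rightarrow> (nat \<Rightarrow> nat) \<Rightarrow> complex mat" where
  "row_perm_mat n p = mat n n (\<lambda>(i, j). if j = p i then 1 else 0)"

definition permute_rows :: "(nat \<Rightarrow> nat) \<Rightarrow> 'a mat \<Rightarrow> 'a mat" where
  "permute_rows p x = mat (dim_row x) (dim_col x) (\<lambda>(i, j). x $$ (p i, j))"

definition off_diag :: "('v \<Rightarrow> 'v) \<Rightarrow> 'v::zero mat \<Rightarrow> 'v mat" where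
  "off_diag star v =
     four_block_mat (0\<^sub>m (dim_row v) (dim_row v)) v (star_mat star v) (0\<^sub>m (dim_col v) (dim_col v))"

text \<open>The matrix only reorders the coordinates of a vector, so every image of a vector in the
  unit ball keeps its Euclidean norm.\<close>

lemma op_norm_row_perm_mat_le:
  assumes p: "bij_betw p {..<n} {..<n}"
  shows "op_norm (row_perm_mat n p) \<le> 1"
  unfolding op_norm_def
proof (rule cSup_least)
  \<comment> \<open>A real supremum is bounded by its upper bounds only over a nonempty set; the
    zero vector provides an element.\<close>
  show "{L2_set (\<lambda>i. cmod ((row_perm_mat n p *\<^sub>v x) $ i)) {..<dim_row (row_perm_mat n p)} | x.
     x \<in> carrier_vec (dim_col (row_perm_mat n p)) \<and>
     L2_set (\<lambda>j. cmod (x $ j)) {..<dim_col (row_perm_mat n p)} \<le> 1} \<noteq> {}"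
    by (auto intro!: exI[of _ "0\<^sub>v n"] simp: row_perm_mat_def L2_set_def)
next
  fix t
  assume "t \<in> {L2_set (\<lambda>i. cmod ((row_perm_mat n p *\<^sub>v x) $ i)) {..<dim_row (row_perm_mat n p)} | x.
     x \<in> carrier_vec (dim_col (row_perm_mat n p)) \<and>
     L2_set (\<lambda>j. cmod (x $ j)) {..<dim_col (row_perm_mat n p)} \<le> 1}"
  then obtain x where x: "x \<in> carrier_vec n" "L2_set (\<lambda>j. cmod (x $ j)) {..<n} \<le> 1"
    and t: "t = L2_set (\<lambda>i. cmod ((row_perm_mat n p *\<^sub>v x) $ i)) {..<n}"
    by (auto simp: row_perm_mat_def)
  have "(row_perm_mat n p *\<^sub>v x) $ i = x $ p i" if "i < n" for i
  proof -
    have "p i < n" using p that by (auto simp: bij_betw_def)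
    have "(row_perm_mat n p *\<^sub>v x) $ i = (\<Sum>k<n. (if k = p i then 1 else 0) * x $ k)"
      using that x by (auto simp: row_perm_mat_def scalar_prod_def lessThan_atLeast0 intro!: sum.cong)
    also have "\<dots> = (\<Sum>k<n. if k = p i then x $ k else 0)"
      by (intro sum.cong) auto
    also have "\<dots> = x $ p i"
      using \<open>p i < n\<close> by simp
    finally show ?thesis .
  qed
  then have "t = sqrt (\<Sum>i<n. (cmod (x $ p i))\<^sup>2)"
    by (simp add: t L2_set_def)
  also have "\<dots> = L2_set (\<lambda>j. cmod (x $ j)) {..<n}"
    unfolding L2_set_def using sum.reindex_bij_betw[OF p, of "\<lambda>j. (cmod (x $ j))\<^sup>2"] by simp
  finally show "t \<le> 1" using x by simp
qed

lemma (in matrix_ordered_space) left_mult_row_perm_mat: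
  assumes p: "bij_betw p {..<m} {..<m}" and x: "x \<in> carrier_mat m n"
  shows "left_mult scale (row_perm_mat m p) x = permute_rows p x"
proof (rule eq_matI)
  fix i j assume ij: "i < dim_row (permute_rows p x)" "j < dim_col (permute_rows p x)"
  then have im: "i < m" "j < n" using x by (auto simp: permute_rows_def)
  then have "p i < m" using p by (auto simp: bij_betw_def)
  have "left_mult scale (row_perm_mat m p) x $$ (i, j)
      = (\<Sum>k<m. scale (if k = p i then 1 else 0) (x $$ (k, j)))"
    using im x by (simp add: left_mult_def row_perm_mat_def)
  also have "\<dots> = (\<Sum>k<m. if k = p i then x $$ (k, j) else 0)"
    by (intro sum.cong) auto
  also have "\<dots> = x $$ (p i, j)" using \<open>p i < m\<close> by simp
  finally show "left_mult scale (row_perm_mat m p) x $$ (i, j) = permute_rows p x $$ (i, j)"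
    using im x by (simp add: permute_rows_def)
qed (use x in \<open>auto simp: left_mult_def row_perm_mat_def permute_rows_def\<close>)

lemma (in matrix_ordered_space) right_mult_one_mat:
  assumes x: "x \<in> carrier_mat m n"
  shows "right_mult scale x (1\<^sub>m n) = x"
proof (rule eq_matI)
  fix i j assume ij: "i < dim_row x" "j < dim_col x"
  have "right_mult scale x (1\<^sub>m n) $$ (i, j) = (\<Sum>k<n. scale (if k = j then 1 else 0) (x $$ (i, k)))"
    using ij x by (simp add: right_mult_def)
  also have "\<dots> = (\<Sum>k<n. if k = j then x $$ (i, k) else 0)"
    by (intro sum.cong) auto
  also have "\<dots> = x $$ (i, j)" using ij x by simp
  finally show "right_mult scale x (1\<^sub>m n) $$ (i, j) = x $$ (i, j)" .
qed (use x in \<open>auto simp: right_mult_def\<close>)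

section \<open>Order and absolute value in one space\<close>

context absolute_matrix_order_unit_space
begin

abbreviation rscale :: "real \<Rightarrow> 'v mat \<Rightarrow> 'v mat" where
  "rscale k \<equiv> smult_mat_space scale (complex_of_real k)"

lemma star_zero: "star 0 = 0"
  using star_add[of 0 0] by simp

lemma pos_subset: "n > 0 \<Longrightarrow> pos n \<subseteq> selfadjoint_mats star n"
  using ordered[of n] by (simp add: real_ordered_space_def)

lemma pos_carrier: "n > 0 \<Longrightarrow> v \<in> pos n \<Longrightarrow> v \<in> carrier_mat n n"
  using pos_subset by (auto simp: selfadjoint_mats_def)

lemma pos_add: "n > 0 \<Longrightarrow> u \<in> pos n \<Longrightarrow> v \<in> pos n \<Longrightarrow> u + v \<in> pos n"
  using ordered[of n] by (simp add: real_ordered_space_def)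

lemma pos_rscale: "n > 0 \<Longrightarrow> k \<ge> 0 \<Longrightarrow> v \<in> pos n \<Longrightarrow> rscale k v \<in> pos n"
  using ordered[of n] by (simp add: real_ordered_space_def)

lemma abs_eq_self: "n > 0 \<Longrightarrow> v \<in> pos n \<Longrightarrow> absm v = v"
  using absolutely_ordered[of n] by (simp add: absolutely_ordered_space_def)

lemma abs_rscale: "n > 0 \<Longrightarrow> v \<in> selfadjoint_mats star n \<Longrightarrow> absm (rscale k v) = rscale \<bar>k\<bar> (absm v)"
  using absolutely_ordered[of n] by (simp add: absolutely_ordered_space_def)

lemma selfadjoint_diff:
  assumes "n > 0" "u \<in> selfadjoint_mats star n" "v \<in> selfadjoint_mats star n"
  shows "u - v \<in> selfadjoint_mats star n"
proof -
  have "u + rscale (-1) v \<in> selfadjoint_mats star n"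
    using ordered[OF assms(1)] assms unfolding real_ordered_space_def by blast
  moreover have "u + rscale (-1) v = u - v"
    using assms by (auto simp: selfadjoint_mats_def smult_mat_space_def)
  ultimately show ?thesis by simp
qed

text \<open>The two differences are negatives of each other, and homogeneity with factor -1 makes
  the absolute value blind to the sign.\<close>

lemma abs_minus_commute:
  assumes "n > 0" "u \<in> selfadjoint_mats star n" "v \<in> selfadjoint_mats star n"
  shows "absm (u - v) = absm (v - u)"
proof -
  have "v - u = rscale (-1) (u - v)"
    using assms by (auto simp: selfadjoint_mats_def smult_mat_space_def)
  moreover have "rscale 1 (absm (u - v)) = absm (u - v)"
    by (rule eq_matI) (auto simp: smult_mat_space_def)
  ultimately show ?thesis
    using abs_rscale[OF assms(1) selfadjoint_diff[OF assms], of "-1"] by simp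
qed

lemma rscale_inject:
  assumes "k \<noteq> 0" "rscale k u = rscale k v"
  shows "u = v"
proof -
  have "rscale (inverse k) (rscale k w) = w" for w
    using assms(1) by (intro eq_matI) (auto simp: smult_mat_space_def simp flip: of_real_mult)
  then show ?thesis using assms(2) by metis
qed

text \<open>The axiom \<open>proper\<close> concerns size 1 only. At size \<open>n\<close> the
  absolute value does the work: if \<open>d\<close> and \<open>-d\<close> are both positive, each
  equals its own absolute value, and these two absolute values agree. So \<open>d = -d\<close>,
  which doubles to \<open>2u = 2v\<close> for \<open>d = u - v\<close>.\<close>

lemma pos_antisym:
  assumes n: "n > 0" and u: "u \<in> carrier_mat n n" "v \<in> carrier_mat n n"
    and le: "u - v \<in> pos n" "v - u \<in> pos n"
  shows "u = v"
proof -
  have sa: "u - v \<in> selfadjoint_mats star n" using pos_subset[OF n] le by auto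
  have "v - u = rscale (-1) (u - v)"
    using u by (auto simp: smult_mat_space_def)
  then have "v - u = absm (rscale (-1) (u - v))"
    using abs_eq_self[OF n le(2)] by simp
  also have "\<dots> = rscale 1 (u - v)"
    using abs_rscale[OF n sa, of "-1"] abs_eq_self[OF n le(1)] by simp
  finally have eq: "v - u = rscale 1 (u - v)" .
  show ?thesis
  proof (rule rscale_inject[of 2], simp, rule eq_matI)
    fix i j assume ij: "i < dim_row (rscale 2 v)" "j < dim_col (rscale 2 v)"
    then have "(v - u) $$ (i, j) = rscale 1 (u - v) $$ (i, j)" using eq by simp
    then have "v $$ (i, j) - u $$ (i, j) = u $$ (i, j) - v $$ (i, j)"
      using ij u by (simp add: smult_mat_space_def)
    then have "v $$ (i, j) + v $$ (i, j) = u $$ (i, j) + u $$ (i, j)"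
      by (simp add: algebra_simps)
    moreover have "scale 2 y = y + y" for y
      using scale_left_distrib[of 1 1 y] by simp
    ultimately show "rscale 2 u $$ (i, j) = rscale 2 v $$ (i, j)"
      using ij u by (simp add: smult_mat_space_def)
  qed (use u in \<open>auto simp: smult_mat_space_def\<close>)
qed

section \<open>Row permutations and the absolute value\<close>

text \<open>With the identity as right factor, \<open>abs_mult\<close> bounds the absolute value of
  the product by \<open>op_norm \<alpha>\<close> times \<open>absm x\<close>.\<close>

lemma abs_left_mult_contraction:
  assumes m: "m > 0" "n > 0" and \<alpha>: "\<alpha> \<in> carrier_mat r m" "op_norm \<alpha> \<le> 1" "r > 0"
    and x: "x \<in> carrier_mat m n"
  shows "absm x - absm (left_mult scale \<alpha> x) \<in> pos n"
proof -
  let ?y = "left_mult scale \<alpha> x" and ?k = "op_norm \<alpha>"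
  have y: "?y \<in> carrier_mat r n" using \<alpha> x by (auto simp: left_mult_def)
  have px: "absm x \<in> pos n" and py: "absm ?y \<in> pos n"
    using abs_pos m \<alpha> x y by blast+
  have cx: "absm x \<in> carrier_mat n n" and cy: "absm ?y \<in> carrier_mat n n"
    using pos_carrier m px py by blast+
  have "rscale ?k (absm x) - absm ?y \<in> pos n"
    using abs_mult[OF m \<alpha>(3) m(2) x \<alpha>(1) one_carrier_mat]
    by (simp add: right_mult_one_mat[OF cx] right_mult_one_mat[OF y] abs_eq_self[OF m(2) px])
  \<comment> \<open>This positive remainder raises the factor \<open>?k\<close> to 1.\<close>
  moreover have "rscale (1 - ?k) (absm x) \<in> pos n"
    using pos_rscale[OF m(2) _ px, of "1 - ?k"] \<alpha> by (simp del: of_real_diff)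
  ultimately have "rscale (1 - ?k) (absm x) + (rscale ?k (absm x) - absm ?y) \<in> pos n"
    using pos_add[OF m(2)] by blast
  moreover have "rscale (1 - ?k) (absm x) + (rscale ?k (absm x) - absm ?y) = absm x - absm ?y"
    using cx cy by (intro eq_matI) (auto simp: smult_mat_space_def scale_left_diff_distrib)
  ultimately show ?thesis by simp
qed

text \<open>Both \<open>p\<close> and its inverse act by contractions, so neither can increase the
  absolute value; the two inequalities give equality by \<open>pos_antisym\<close>.\<close>

lemma abs_permute_rows:
  assumes m: "m > 0" "n > 0" and p: "bij_betw p {..<m} {..<m}" and x: "x \<in> carrier_mat m n"
  shows "absm (permute_rows p x) = absm x"
proof -
  have le: "absm y - absm (permute_rows q y) \<in> pos n"
    if "bij_betw q {..<m} {..<m}" "y \<in> carrier_mat m n" for q y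
    using abs_left_mult_contraction[OF m _ op_norm_row_perm_mat_le[OF that(1)] m(1) that(2)]
    by (simp add: left_mult_row_perm_mat[OF that]) (simp add: row_perm_mat_def)
  let ?q = "inv_into {..<m} p"
  have y: "permute_rows p x \<in> carrier_mat m n" using x by (simp add: permute_rows_def)
  have "p (?q i) = i" if "i < m" for i
    using p that by (simp add: bij_betw_inv_into_right)
  moreover have "?q i < m" if "i < m" for i
    using bij_betw_inv_into[OF p] that by (auto simp: bij_betw_def)
  ultimately have "permute_rows ?q (permute_rows p x) = x"
    using x by (intro eq_matI) (auto simp: permute_rows_def)
  then have "absm (permute_rows p x) - absm x \<in> pos n"
    using le[OF bij_betw_inv_into[OF p] y] by simp
  then show ?thesis
    using le[OF p x] pos_antisym[OF m(2)] pos_carrier[OF m(2)] abs_pos[OF m x] abs_pos[OF m y]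
    by blast
qed

lemma off_diag_selfadjoint:
  assumes "v \<in> carrier_mat n n"
  shows "off_diag star v \<in> selfadjoint_mats star (n + n)"
  using assms
  by (auto simp: selfadjoint_mats_def off_diag_def star_mat_def star_star star_zero intro!: eq_matI)

lemma abs_off_diag:
  assumes n: "n > 0" and v: "v \<in> carrier_mat n n"
  shows "absm (off_diag star v) = mat_direct_sum (absm (star_mat star v)) (absm v)"
proof -
  \<comment> \<open>This map exchanges the upper and the lower \<open>n\<close> rows and is its own
    inverse. It moves \<open>v\<close> to the upper right and its adjoint to the lower left.\<close>
  let ?p = "\<lambda>i. if i < n then i + n else i - n"
  let ?x = "mat_direct_sum (star_mat star v) v"
  have sv: "star_mat star v \<in> carrier_mat n n" using v by (simp add: star_mat_def)
  have x: "?x \<in> carrier_mat (n + n) (n + n)" using v sv by (simp add: mat_direct_sum_def)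
  have "bij_betw ?p {..<n + n} {..<n + n}"
    by (rule bij_betw_byWitness[where f' = ?p]) auto
  moreover have "permute_rows ?p ?x = off_diag star v"
    using v sv by (intro eq_matI) (auto simp: permute_rows_def off_diag_def mat_direct_sum_def)
  ultimately show ?thesis
    using abs_permute_rows[OF _ _ _ x, of ?p] abs_direct_sum[OF n n n n sv v] n by simp
qed

section \<open>Symmetry and additivity of orthogonality on the cone\<close>

lemma orthogonal_commute:
  assumes "n > 0" "u \<in> selfadjoint_mats star n" "v \<in> selfadjoint_mats star n"
    and "orthogonal_wrt absm u v"
  shows "orthogonal_wrt absm v u"
  using assms abs_minus_commute[OF assms(1-3)]
  by (auto simp: orthogonal_wrt_def selfadjoint_mats_def comm_add_mat)

text \<open>The last axiom of an absolutely ordered space gives orthogonality to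
  \<open>absm (v + w)\<close>, which on the cone is \<open>v + w\<close> itself.\<close>

lemma orthogonal_add_right:
  assumes n: "n > 0" and u: "u \<in> pos n" "v \<in> pos n" "w \<in> pos n"
    and "orthogonal_wrt absm u v" "orthogonal_wrt absm u w"
  shows "orthogonal_wrt absm u (v + w)"
proof -
  have "absm (u - absm (v + w)) = u + absm (v + w)"
    using absolutely_ordered[OF n] pos_subset[OF n] assms
    unfolding absolutely_ordered_space_def orthogonal_wrt_def by blast
  then show ?thesis
    using abs_eq_self[OF n pos_add[OF n u(2,3)]] by (simp add: orthogonal_wrt_def)
qed

lemma orthogonal_add_left:
  assumes n: "n > 0" and u: "u \<in> pos n" "v \<in> pos n" "w \<in> pos n"
    and "orthogonal_wrt absm v u" "orthogonal_wrt absm w u"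
  shows "orthogonal_wrt absm (v + w) u"
proof -
  have sa: "u \<in> selfadjoint_mats star n" "v \<in> selfadjoint_mats star n"
    "w \<in> selfadjoint_mats star n" "v + w \<in> selfadjoint_mats star n"
    using pos_subset[OF n] u pos_add[OF n u(2,3)] by auto
  show ?thesis
    using orthogonal_commute[OF n sa(1,4)] orthogonal_add_right[OF n u]
      orthogonal_commute[OF n sa(2,1)] orthogonal_commute[OF n sa(3,1)] assms by blast
qed

end

section \<open>Maps between two spaces\<close>

text \<open>Since \<theta> respects zero and the involution, its amplification commutes with
  \<open>off_diag\<close>, so the self-adjoint case at size \<open>n + n\<close> applies.\<close>

lemma completely_abs_preserving_if_selfadjoint:
  fixes \<theta> :: "'v::ab_group_add \<Rightarrow> 'w::ab_group_add"
  assumes V: "absolute_matrix_order_unit_space scaleV starV posV eV absV"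
    and W: "absolute_matrix_order_unit_space scaleW starW posW eW absW"
    and lin: "Vector_Spaces.linear scaleV scaleW \<theta>" and star: "\<And>v. \<theta> (starV v) = starW (\<theta> v)"
    and sa: "\<And>n v. n > 0 \<Longrightarrow> v \<in> selfadjoint_mats starV n \<Longrightarrow>
      absW (map_mat \<theta> v) = map_mat \<theta> (absV v)"
  shows "completely_abs_preserving scaleV starV absV scaleW starW absW \<theta>"
  unfolding completely_abs_preserving_def
proof (intro conjI allI impI ballI)
  interpret V: absolute_matrix_order_unit_space scaleV starV posV eV absV by fact
  interpret W: absolute_matrix_order_unit_space scaleW starW posW eW absW by fact
  interpret \<theta>: Vector_Spaces.linear scaleV scaleW \<theta> by fact
  fix n :: nat and v :: "'v mat" assume n: "n > 0" and v: "v \<in> carrier_mat n n"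
  let ?sv = "star_mat starV v" and ?\<theta>v = "map_mat \<theta> v"
  have sv: "?sv \<in> carrier_mat n n" using v by (simp add: star_mat_def)
  have cV: "absV v \<in> carrier_mat n n" "absV ?sv \<in> carrier_mat n n"
    using V.pos_carrier[OF n] V.abs_pos[OF n n] v sv by blast+
  have \<theta>v: "?\<theta>v \<in> carrier_mat n n" "star_mat starW ?\<theta>v \<in> carrier_mat n n"
    using v by (auto simp: star_mat_def)
  have cW: "absW ?\<theta>v \<in> carrier_mat n n" "absW (star_mat starW ?\<theta>v) \<in> carrier_mat n n"
    using W.pos_carrier[OF n] W.abs_pos[OF n n] \<theta>v by blast+
  have "off_diag starW ?\<theta>v = map_mat \<theta> (off_diag starV v)"
    using v by (intro eq_matI) (auto simp: off_diag_def star_mat_def star \<theta>.zero)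
  then have "mat_direct_sum (absW (star_mat starW ?\<theta>v)) (absW ?\<theta>v)
      = absW (map_mat \<theta> (off_diag starV v))"
    using W.abs_off_diag[OF n \<theta>v(1)] by simp
  also have "\<dots> = map_mat \<theta> (mat_direct_sum (absV ?sv) (absV v))"
    using sa[OF _ V.off_diag_selfadjoint[OF v]] V.abs_off_diag[OF n v] n by simp
  finally have eq: "mat_direct_sum (absW (star_mat starW ?\<theta>v)) (absW ?\<theta>v)
      = map_mat \<theta> (mat_direct_sum (absV ?sv) (absV v))" .
  show "absW ?\<theta>v = map_mat \<theta> (absV v)"
  proof (rule eq_matI)
    fix i j assume ij: "i < dim_row (map_mat \<theta> (absV v))" "j < dim_col (map_mat \<theta> (absV v))"
    then have "i < n" "j < n" using cV by auto
    \<comment> \<open>The absolute value of \<open>v\<close> itself is the lower right block, hence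
      the offset \<open>n\<close> in both indices.\<close>
    then show "absW ?\<theta>v $$ (i, j) = map_mat \<theta> (absV v) $$ (i, j)"
      using arg_cong[OF eq, of "\<lambda>M. M $$ (n + i, n + j)"] cV cW
      by (simp add: mat_direct_sum_def)
  qed (use cV cW in auto)
qed (use lin star in auto)

theorem theorem5p9:
  fixes scaleV :: "complex \<Rightarrow> 'v::ab_group_add \<Rightarrow> 'v"
    and starV :: "'v \<Rightarrow> 'v"
    and posV :: "nat \<Rightarrow> 'v mat set"
    and eV :: 'v
    and absV :: "'v mat \<Rightarrow> 'v mat"
    and scaleW :: "complex \<Rightarrow> 'w::ab_group_add \<Rightarrow> 'w"
    and starW :: "'w \<Rightarrow> 'w"
    and posW :: "nat \<Rightarrow> 'w mat set"
    and eW :: 'w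
    and absW :: "'w mat \<Rightarrow> 'w mat"
    and \<phi> \<psi> :: "'v \<Rightarrow> 'w"
  assumes "absolute_matrix_order_unit_space scaleV starV posV eV absV"
    and "absolute_matrix_order_unit_space scaleW starW posW eW absW"
    and "completely_abs_preserving scaleV starV absV scaleW starW absW \<phi>"
    and "completely_abs_preserving scaleV starV absV scaleW starW absW \<psi>"
    and "completely_orthogonal scaleV posV scaleW posW absW \<phi> \<psi>"
  shows "completely_abs_preserving scaleV starV absV scaleW starW absW (\<lambda>v. \<phi> v + \<psi> v)"
proof (rule completely_abs_preserving_if_selfadjoint[OF assms(1,2)])
  interpret V: absolute_matrix_order_unit_space scaleV starV posV eV absV by fact
  interpret W: absolute_matrix_order_unit_space scaleW starW posW eW absW by fact
  have lin: "Vector_Spaces.linear scaleV scaleW \<phi>" "Vector_Spaces.linear scaleV scaleW \<psi>"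
    and star: "\<And>v. \<phi> (starV v) = starW (\<phi> v)" "\<And>v. \<psi> (starV v) = starW (\<psi> v)"
    and abs: "\<And>n v. n > 0 \<Longrightarrow> v \<in> carrier_mat n n \<Longrightarrow> absW (map_mat \<phi> v) = map_mat \<phi> (absV v)"
      "\<And>n v. n > 0 \<Longrightarrow> v \<in> carrier_mat n n \<Longrightarrow> absW (map_mat \<psi> v) = map_mat \<psi> (absV v)"
    using assms(3,4) by (auto simp: completely_abs_preserving_def)
  interpret \<phi>: Vector_Spaces.linear scaleV scaleW \<phi> by fact
  interpret \<psi>: Vector_Spaces.linear scaleV scaleW \<psi> by fact
  let ?\<theta> = "\<lambda>v. \<phi> v + \<psi> v"
  interpret vector_space_pair scaleV scaleW ..
  show "Vector_Spaces.linear scaleV scaleW ?\<theta>"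
    using lin by (rule linear_compose_add)
  then interpret \<theta>: Vector_Spaces.linear scaleV scaleW ?\<theta> .
  show star\<theta>: "?\<theta> (starV v) = starW (?\<theta> v)" for v
    by (simp add: star W.star_add)
  fix n :: nat and v assume n: "n > 0" and v: "v \<in> selfadjoint_mats starV n"
  \<comment> \<open>These are twice the positive and negative parts of \<open>v\<close>; keeping the
    factor 2 avoids halving until the final cancellation.\<close>
  define p m where "p = absV v + v" and "m = absV v - v"
  have pos: "p \<in> posV n" "m \<in> posV n"
    using V.absolutely_ordered[OF n] v by (auto simp: absolutely_ordered_space_def p_def m_def)
  have cv: "v \<in> carrier_mat n n" using v by (simp add: selfadjoint_mats_def)
  have ca: "absV v \<in> carrier_mat n n"
    using V.pos_carrier[OF n V.abs_pos[OF n n cv]] .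
  have c: "p \<in> carrier_mat n n" "m \<in> carrier_mat n n"
    using pos V.pos_carrier[OF n] by auto
  have two: "scaleV 2 x = x + x" "scaleW 2 y = y + y" for x y
    using V.scale_left_distrib[of 1 1 x] W.scale_left_distrib[of 1 1 y] by simp_all
  have pm: "p - m = V.rscale 2 v" "p + m = V.rscale 2 (absV v)"
    using ca cv by (auto intro!: eq_matI simp: p_def m_def smult_mat_space_def two)
  \<comment> \<open>That is, \<open>p\<close> and \<open>m\<close> are orthogonal.\<close>
  have abs_pm: "absV (p - m) = p + m"
    using V.abs_rscale[OF n v, of 2] by (simp add: pm)
  have add: "map_mat f (p + m) = map_mat f p + map_mat f m"
      "map_mat f (p - m) = map_mat f p - map_mat f m"
    if "Vector_Spaces.linear scaleV scaleW f" for f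
    using c linear_add[OF that] linear_diff[OF that] by (auto intro!: eq_matI)
  \<comment> \<open>A linear map commuting with the absolute value carries the orthogonality of
    \<open>p\<close> and \<open>m\<close> over to their images.\<close>
  have self: "orthogonal_wrt absW (map_mat f p) (map_mat f m)"
    if "Vector_Spaces.linear scaleV scaleW f"
      "\<And>v. v \<in> carrier_mat n n \<Longrightarrow> absW (map_mat f v) = map_mat f (absV v)" for f
    using that(2)[OF minus_carrier_mat[OF c(2), of p]] add[OF that(1)]
    by (simp add: orthogonal_wrt_def abs_pm)
  have posW: "map_mat \<phi> p \<in> posW n" "map_mat \<phi> m \<in> posW n"
      "map_mat \<psi> p \<in> posW n" "map_mat \<psi> m \<in> posW n"
    and cross: "orthogonal_wrt absW (map_mat \<phi> p) (map_mat \<psi> m)"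
      "orthogonal_wrt absW (map_mat \<phi> m) (map_mat \<psi> p)"
    using assms(5) pos n by (auto simp: completely_orthogonal_def completely_positive_def)
  \<comment> \<open>Complete orthogonality is stated with \<phi> on the left, so this pair comes
    from the reversed one by symmetry.\<close>
  have cross': "orthogonal_wrt absW (map_mat \<psi> p) (map_mat \<phi> m)"
    using W.orthogonal_commute[OF n _ _ cross(2)] W.pos_subset[OF n] posW by auto
  \<comment> \<open>All four pairs of images are orthogonal: sum first on the right for each of
    \<phi> and \<psi>, then on the left.\<close>
  have "orthogonal_wrt absW (map_mat \<phi> p + map_mat \<psi> p) (map_mat \<phi> m + map_mat \<psi> m)"
    by (rule W.orthogonal_add_left[OF n W.pos_add[OF n posW(2,4)] posW(1,3)
        W.orthogonal_add_right[OF n posW(1,2,4) self[OF lin(1) abs(1)[OF n]] cross(1)]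
        W.orthogonal_add_right[OF n posW(3,2,4) cross' self[OF lin(2) abs(2)[OF n]]]])
  moreover have "map_mat \<phi> x + map_mat \<psi> x = map_mat ?\<theta> x" for x
    by (intro eq_matI) auto
  ultimately have "absW (map_mat ?\<theta> (p - m)) = map_mat ?\<theta> (p + m)"
    using add[OF \<theta>.linear_axioms] by (simp add: orthogonal_wrt_def)
  moreover have "map_mat ?\<theta> (V.rscale 2 x) = W.rscale 2 (map_mat ?\<theta> x)" for x
    using \<theta>.scale by (auto intro!: eq_matI simp: smult_mat_space_def)
  \<comment> \<open>Homogeneity of \<open>absW\<close> holds on self-adjoint matrices, and it is
    what pulls the factor 2 out of the absolute value.\<close>
  moreover have "map_mat ?\<theta> v \<in> selfadjoint_mats starW n"
  proof -
    have "star_mat starW (map_mat ?\<theta> v) = map_mat ?\<theta> (star_mat starV v)"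
      by (intro eq_matI) (auto simp: star_mat_def star\<theta>)
    then show ?thesis using v by (simp add: selfadjoint_mats_def)
  qed
  ultimately have "W.rscale 2 (absW (map_mat ?\<theta> v)) = W.rscale 2 (map_mat ?\<theta> (absV v))"
    using W.abs_rscale[OF n, of "map_mat ?\<theta> v" 2] by (simp add: pm)
  then show "absW (map_mat ?\<theta> v) = map_mat ?\<theta> (absV v)"
    by (rule W.rscale_inject[rotated]) simp
qed

end
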